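(* Let $T$ be a tree and let $G\le\mathrm{Aut}(T)$. Then for all $k\in\mathbb{N}$ (i.e. $k\ge1$) we have $\mathrm{Type}(G)=\mathrm{Type}(\overline{G})=\mathrm{Type}\big(G^{(P_k)}\big)$.
   Context: $T$ is not assumed locally finite. $\mathrm{Aut}(T)$ carries the permutation topology for its action on $VT$ (basis: left translates of pointwise stabilisers of finite vertex sets), and $\overline{G}$ is the closure of $G$. $B(v,k)$ denotes the ball of radius $k$ around the vertex $v$. The $(P_k)$-closure of $G$ is $$G^{(P_k)}=\{h\in\mathrm{Aut}(T)\mid\forall v\in VT\ \forall X\subseteq V(B(v,k))\text{ finite}\ \exists g\in G:\ g|_X=h|_X\}.$$ An end of $T$ is an equivalence class of rays, two rays being equivalent if some ray contains infinitely many vertices of both. Every group acting on a tree belongs to exactly one of the following types, and $\mathrm{Type}(G)$ denotes that type: (Fixed vertex) it fixes a (not necessarily unique) vertex; (Inversion) it preserves a unique edge and contains an inversion of that edge; (Lineal) it fixes exactly two ends and translates the line between them; (Focal) it fixes a unique end and contains a translation towards this end; (Horocyclic) it fixes a unique end but no vertices, and acts without translation; (General) it acts with translation and does not fix any end. *)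

theory Defs
  imports
    "HOL-Algebra.Bij"
    "HOL-Algebra.Coset"
    "HOL-Analysis.Abstract_Topology"
    "Graph_Theory.Graph_Theory"
begin

section \<open>Trees and their automorphism groups\<close>

text \<open>
  Undirected simple graphs, finite or infinite, are symmetric loop-free digraphs without parallel
  arcs. The constant \<open>tree\<close> of the graph library is not usable here: its cycles are
  directed and may have length two, so no graph with a symmetric pair of arcs is a tree in that
  sense. A cycle of the undirected graph is a cycle of length at least three. Connectedness
  includes that there is at least one vertex.
\<close>

definition is_tree :: "'v pair_pre_digraph \<Rightarrow> bool" where
  "is_tree T \<longleftrightarrow>
     pair_bidirected_digraph T \<and> Digraph_Component.connected T \<and>
     \<not> (\<exists>p. pre_digraph.cycle T p \<and> 3 \<le> length p)"

text \<open>
  The elements of \<^const>\<open>Bij\<close> are extensional functions, so automorphisms are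
  determined by their values on the vertex set.
\<close>

definition Aut :: "'v pair_pre_digraph \<Rightarrow> ('v \<Rightarrow> 'v) monoid" where
  "Aut T = (BijGroup (pverts T))
     \<lparr>carrier := {f \<in> Bij (pverts T). \<forall>u\<in>pverts T. \<forall>v\<in>pverts T.
        (f u, f v) \<in> parcs T \<longleftrightarrow> (u, v) \<in> parcs T}\<rparr>"

definition pointwise_stab :: "'v pair_pre_digraph \<Rightarrow> 'v set \<Rightarrow> ('v \<Rightarrow> 'v) set" where
  "pointwise_stab T X = {f \<in> carrier (Aut T). \<forall>x\<in>X. f x = x}"

definition perm_topology :: "'v pair_pre_digraph \<Rightarrow> ('v \<Rightarrow> 'v) topology" where
  "perm_topology T = topology_generated_by
     {f <#\<^bsub>Aut T\<^esub> pointwise_stab T X | f X.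
        f \<in> carrier (Aut T) \<and> finite X \<and> X \<subseteq> pverts T}"

definition gball :: "'v pair_pre_digraph \<Rightarrow> 'v \<Rightarrow> nat \<Rightarrow> 'v set" where
  "gball T v k = {w. \<exists>p. pre_digraph.awalk T v p w \<and> length p \<le> k}"

definition Pk_closure ::
  "'v pair_pre_digraph \<Rightarrow> nat \<Rightarrow> ('v \<Rightarrow> 'v) set \<Rightarrow> ('v \<Rightarrow> 'v) set" where
  "Pk_closure T k G =
     {h \<in> carrier (Aut T). \<forall>v\<in>pverts T. \<forall>X. X \<subseteq> gball T v k \<and> finite X \<longrightarrow>
        (\<exists>g\<in>G. \<forall>x\<in>X. g x = h x)}"

section \<open>Rays, ends and lines\<close>

definition ray :: "'v pair_pre_digraph \<Rightarrow> (nat \<Rightarrow> 'v) \<Rightarrow> bool" where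
  "ray T r \<longleftrightarrow> inj r \<and> (\<forall>n. (r n, r (Suc n)) \<in> parcs T)"

definition ray_equiv :: "'v pair_pre_digraph \<Rightarrow> ((nat \<Rightarrow> 'v) \<times> (nat \<Rightarrow> 'v)) set" where
  "ray_equiv T = {(r, s). ray T r \<and> ray T s \<and>
     (\<exists>t. ray T t \<and> infinite (range t \<inter> range r) \<and> infinite (range t \<inter> range s))}"

definition ends :: "'v pair_pre_digraph \<Rightarrow> (nat \<Rightarrow> 'v) set set" where
  "ends T = {r. ray T r} // ray_equiv T"

definition fixes_end :: "('v \<Rightarrow> 'v) set \<Rightarrow> (nat \<Rightarrow> 'v) set \<Rightarrow> bool" where
  "fixes_end G \<epsilon> \<longleftrightarrow> (\<forall>g\<in>G. (\<lambda>r. g \<circ> r) ` \<epsilon> = \<epsilon>)"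

definition line :: "'v pair_pre_digraph \<Rightarrow> (int \<Rightarrow> 'v) \<Rightarrow> bool" where
  "line T \<gamma> \<longleftrightarrow> inj \<gamma> \<and> (\<forall>i. (\<gamma> i, \<gamma> (i + 1)) \<in> parcs T)"

definition line_between ::
  "'v pair_pre_digraph \<Rightarrow> (int \<Rightarrow> 'v) \<Rightarrow> (nat \<Rightarrow> 'v) set \<Rightarrow> (nat \<Rightarrow> 'v) set \<Rightarrow> bool" where
  "line_between T \<gamma> \<epsilon> \<omega> \<longleftrightarrow>
     line T \<gamma> \<and> (\<lambda>n. \<gamma> (- int n)) \<in> \<epsilon> \<and> (\<lambda>n. \<gamma> (int n)) \<in> \<omega>"

text \<open>The translation goes in the direction of increasing parameter of the line.\<close>

definition translates_line ::
  "'v pair_pre_digraph \<Rightarrow> ('v \<Rightarrow> 'v) \<Rightarrow> (int \<Rightarrow> 'v) \<Rightarrow> bool" where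
  "translates_line T g \<gamma> \<longleftrightarrow> line T \<gamma> \<and> (\<exists>l>0. \<forall>i. g (\<gamma> i) = \<gamma> (i + l))"

definition translation :: "'v pair_pre_digraph \<Rightarrow> ('v \<Rightarrow> 'v) \<Rightarrow> bool" where
  "translation T g \<longleftrightarrow> (\<exists>\<gamma>. translates_line T g \<gamma>)"

definition translation_towards ::
  "'v pair_pre_digraph \<Rightarrow> ('v \<Rightarrow> 'v) \<Rightarrow> (nat \<Rightarrow> 'v) set \<Rightarrow> bool" where
  "translation_towards T g \<epsilon> \<longleftrightarrow> (\<exists>\<gamma>. translates_line T g \<gamma> \<and> (\<lambda>n. \<gamma> (int n)) \<in> \<epsilon>)"

section \<open>Types of groups acting on trees\<close>

text \<open>
  A group is given by its set of automorphisms. A set being equal to a singleton or to a pair of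
  distinct elements says that there is exactly one, or that there are exactly two, of its members.
\<close>

definition fixes_vertex :: "('v \<Rightarrow> 'v) set \<Rightarrow> 'v \<Rightarrow> bool" where
  "fixes_vertex G v \<longleftrightarrow> (\<forall>g\<in>G. g v = v)"

definition edges :: "'v pair_pre_digraph \<Rightarrow> 'v set set" where
  "edges T = {{u, v} | u v. (u, v) \<in> parcs T}"

definition preserves_edge :: "('v \<Rightarrow> 'v) set \<Rightarrow> 'v set \<Rightarrow> bool" where
  "preserves_edge G e \<longleftrightarrow> (\<forall>g\<in>G. g ` e = e)"

definition inverts_edge :: "('v \<Rightarrow> 'v) \<Rightarrow> 'v set \<Rightarrow> bool" where
  "inverts_edge g e \<longleftrightarrow> (\<exists>u v. u \<noteq> v \<and> e = {u, v} \<and> g u = v \<and> g v = u)"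

datatype action_type = Fixed_Vertex | Inversion | Lineal | Focal | Horocyclic | General

primrec has_type :: "'v pair_pre_digraph \<Rightarrow> ('v \<Rightarrow> 'v) set \<Rightarrow> action_type \<Rightarrow> bool" where
  "has_type T G Fixed_Vertex \<longleftrightarrow> (\<exists>v\<in>pverts T. fixes_vertex G v)"
| "has_type T G Inversion \<longleftrightarrow>
     (\<exists>e. {e' \<in> edges T. preserves_edge G e'} = {e} \<and> (\<exists>g\<in>G. inverts_edge g e))"
| "has_type T G Lineal \<longleftrightarrow>
     (\<exists>\<epsilon> \<omega>. \<epsilon> \<noteq> \<omega> \<and> {\<eta> \<in> ends T. fixes_end G \<eta>} = {\<epsilon>, \<omega>} \<and>
        (\<exists>\<gamma>. line_between T \<gamma> \<epsilon> \<omega> \<and> (\<exists>g\<in>G. translates_line T g \<gamma>)))"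
| "has_type T G Focal \<longleftrightarrow>
     (\<exists>\<epsilon>. {\<eta> \<in> ends T. fixes_end G \<eta>} = {\<epsilon>} \<and> (\<exists>g\<in>G. translation_towards T g \<epsilon>))"
| "has_type T G Horocyclic \<longleftrightarrow>
     (\<exists>\<epsilon>. {\<eta> \<in> ends T. fixes_end G \<eta>} = {\<epsilon>}) \<and>
     \<not> (\<exists>v\<in>pverts T. fixes_vertex G v) \<and> \<not> (\<exists>g\<in>G. translation T g)"
| "has_type T G General \<longleftrightarrow>
     (\<exists>g\<in>G. translation T g) \<and> \<not> (\<exists>\<eta>\<in>ends T. fixes_end G \<eta>)"

text \<open>
  The description picks out the type because every group of automorphisms of a tree has exactly
  one; that classification is not proved here. A statement that should not depend on it is to be
  made with \<^const>\<open>has_type\<close>.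
\<close>

definition Type :: "'v pair_pre_digraph \<Rightarrow> ('v \<Rightarrow> 'v) set \<Rightarrow> action_type" where
  "Type T G = (THE \<tau>. has_type T G \<tau>)"

end

theory Submission
  imports Defs
begin

text \<open>
  Every datum in the definition of the types is visible on single edges. Let \<open>h\<close> be an
  element of the closure \<open>Pk_closure T k G\<close>. Since a ball of radius \<open>k \<ge> 1\<close> contains the
  edges at its centre, for each edge some element of \<open>G\<close> agrees with \<open>h\<close> on both of its vertices.
  For fixed vertices, preserved edges and inversions nothing more is needed.

  An end fixed by \<open>G\<close> gives every vertex \<open>x\<close> on one of its rays a next vertex, because in a tree
  at most one ray of the end starts at \<open>x\<close> (\<open>end_ray_unique\<close>). Elements of \<open>G\<close> respect this
  successor relation, and it relates the two vertices of an edge, so \<open>h\<close> respects it as well.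
  Hence \<open>h\<close> maps a ray of the end in the same way as any element of \<open>G\<close> that agrees
  with \<open>h\<close> at the first vertex (\<open>fixed_end_ray_image_eq\<close>), and \<open>h\<close> fixes the end
  (\<open>fixes_end_Pk_closure\<close>).

  Whether an automorphism is a translation with an axis through a given edge can be seen from the
  image of that edge: if \<open>g\<close> moves an oriented edge of a line forward along the line, then the
  images of the traversed segment under the powers of \<open>g\<close> fit together to a line, on which \<open>g\<close>
  translates (\<open>translation_from_agreeing_arc\<close>). So if \<open>h\<close> is a translation, then an element
  of \<open>G\<close> that agrees with \<open>h\<close> on an edge of the axis is one, too. When \<open>G\<close> fixes the end at
  which the axis of \<open>h\<close> points, both axes share a ray of that end; when it fixes both ends
  of the axis, the axes are equal.

  Both facts rest on one property of trees: a two-sided infinite walk without backtracking is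
  injective (\<open>nonbacktracking_inj\<close>). The argument covers every set between \<open>G\<close> and
  its closure \<open>Pk_closure T k G\<close> (\<open>has_type_intermediate\<close>), and the topological closure is such
  a set.
\<close>

section \<open>Automorphisms\<close>

lemma tree_pair_bidirected: "is_tree T \<Longrightarrow> pair_bidirected_digraph T"
  by (simp add: is_tree_def)

lemma tree_arc_in_verts:
  assumes "is_tree T" "(u, v) \<in> parcs T"
  shows "u \<in> pverts T" "v \<in> pverts T"
proof -
  interpret pair_bidirected_digraph T by (rule tree_pair_bidirected[OF assms(1)])
  show "u \<in> pverts T" "v \<in> pverts T"
    using assms(2) arc_fst_in_verts[of "(u, v)"] arc_snd_in_verts[of "(u, v)"] by auto
qed

lemma tree_arc_sym:
  assumes "is_tree T" "(u, v) \<in> parcs T"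
  shows "(v, u) \<in> parcs T"
proof -
  interpret pair_bidirected_digraph T by (rule tree_pair_bidirected[OF assms(1)])
  show ?thesis
    using pair_sym_arcs assms(2) by (auto simp: symmetric_def elim: symE)
qed

lemma tree_arc_neq:
  assumes "is_tree T" "(u, v) \<in> parcs T"
  shows "u \<noteq> v"
proof -
  interpret pair_bidirected_digraph T by (rule tree_pair_bidirected[OF assms(1)])
  show ?thesis
    using pair_no_loops[OF assms(2)] by simp
qed

lemma Aut_subgroup_BijGroup: "subgroup (carrier (Aut T)) (BijGroup (pverts T))"
proof -
  interpret B: group "BijGroup (pverts T)" by (rule group_BijGroup)
  show ?thesis
  proof (rule B.subgroupI)
    show "carrier (Aut T) \<subseteq> carrier (BijGroup (pverts T))"
      by (auto simp: Aut_def BijGroup_def)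
    have "(\<lambda>x\<in>pverts T. x) \<in> carrier (Aut T)"
      by (auto simp: Aut_def id_Bij)
    then show "carrier (Aut T) \<noteq> {}"
      by auto
  next
    fix f assume f: "f \<in> carrier (Aut T)"
    then have b: "f \<in> Bij (pverts T)"
      by (simp add: Aut_def)
    have img: "f ` pverts T = pverts T"
      using b by (simp add: Bij_def bij_betw_def)
    have "(inv_into (pverts T) f u, inv_into (pverts T) f v) \<in> parcs T \<longleftrightarrow> (u, v) \<in> parcs T"
      if "u \<in> pverts T" "v \<in> pverts T" for u v
    proof -
      have "(f (inv_into (pverts T) f u), f (inv_into (pverts T) f v)) \<in> parcs T \<longleftrightarrow>
          (inv_into (pverts T) f u, inv_into (pverts T) f v) \<in> parcs T"
        using f that Bij_inv_into_mem[OF b] by (simp add: Aut_def)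
      then show ?thesis
        using that img by (simp add: f_inv_into_f)
    qed
    then show "inv\<^bsub>BijGroup (pverts T)\<^esub> f \<in> carrier (Aut T)"
      using b restrict_inv_into_Bij[OF b] by (simp add: inv_BijGroup Aut_def)
  next
    fix f g assume fg: "f \<in> carrier (Aut T)" "g \<in> carrier (Aut T)"
    then have b: "f \<in> Bij (pverts T)" "g \<in> Bij (pverts T)"
      by (simp_all add: Aut_def)
    then have "g u \<in> pverts T" if "u \<in> pverts T" for u
      using that Bij_imp_funcset by fastforce
    then show "f \<otimes>\<^bsub>BijGroup (pverts T)\<^esub> g \<in> carrier (Aut T)"
      using fg b compose_Bij[OF b] by (auto simp: Aut_def BijGroup_def compose_def)
  qed
qed

lemma group_Aut: "group (Aut T)"
proof -
  have "Aut T = BijGroup (pverts T)\<lparr>carrier := carrier (Aut T)\<rparr>"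
    by (simp add: Aut_def)
  then show ?thesis
    using group.subgroup_imp_group[OF group_BijGroup Aut_subgroup_BijGroup] by metis
qed

lemma Aut_inj_on: "g \<in> carrier (Aut T) \<Longrightarrow> inj_on g (pverts T)"
  by (simp add: Aut_def Bij_def bij_betw_def)

lemma Aut_arc:
  assumes "is_tree T" "g \<in> carrier (Aut T)" "(u, v) \<in> parcs T"
  shows "(g u, g v) \<in> parcs T"
  using assms tree_arc_in_verts[OF assms(1,3)] by (simp add: Aut_def)

lemma Aut_mult_apply:
  assumes "f \<in> carrier (Aut T)" "g \<in> carrier (Aut T)" "x \<in> pverts T"
  shows "(f \<otimes>\<^bsub>Aut T\<^esub> g) x = f (g x)"
  using assms by (simp add: Aut_def BijGroup_def compose_def)

lemma Aut_one_apply: "x \<in> pverts T \<Longrightarrow> \<one>\<^bsub>Aut T\<^esub> x = x"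
  by (simp add: Aut_def BijGroup_def)

lemma Aut_inv_apply:
  assumes "g \<in> carrier (Aut T)" "x \<in> pverts T"
  shows "(inv\<^bsub>Aut T\<^esub> g) (g x) = x" "g ((inv\<^bsub>Aut T\<^esub> g) x) = x"
proof -
  interpret A: group "Aut T" by (rule group_Aut)
  show "(inv\<^bsub>Aut T\<^esub> g) (g x) = x"
    using assms Aut_mult_apply[of "inv\<^bsub>Aut T\<^esub> g" T g x] by (simp add: Aut_one_apply)
  show "g ((inv\<^bsub>Aut T\<^esub> g) x) = x"
    using assms Aut_mult_apply[of g T "inv\<^bsub>Aut T\<^esub> g" x] by (simp add: Aut_one_apply)
qed

section \<open>Walks without backtracking\<close>

lemma (in pair_wf_digraph) awalk_of_sequence:
  assumes "\<And>i. i < n \<Longrightarrow> (w i, w (Suc i)) \<in> parcs G" "w 0 \<in> pverts G"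
  shows "awalk (w 0) (map (\<lambda>i. (w i, w (Suc i))) [0..<n]) (w n) \<and>
    pawalk_verts (w 0) (map (\<lambda>i. (w i, w (Suc i))) [0..<n]) = map w [0..<Suc n]"
  using assms
proof (induction n arbitrary: w)
  case 0
  then show ?case
    by (simp add: awalk_def)
next
  case (Suc n)
  let ?w = "\<lambda>i. w (Suc i)"
  have arc: "(w 0, ?w 0) \<in> parcs G"
    using Suc.prems(1)[of 0] by simp
  then have "?w 0 \<in> pverts G"
    using arc_snd_in_verts[of "(w 0, ?w 0)"] by simp
  then have IH: "awalk (?w 0) (map (\<lambda>i. (?w i, ?w (Suc i))) [0..<n]) (?w n)"
      "pawalk_verts (?w 0) (map (\<lambda>i. (?w i, ?w (Suc i))) [0..<n]) = map ?w [0..<Suc n]"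
    using Suc.IH[of ?w] Suc.prems(1) by simp_all
  have upt: "[0..<Suc m] = 0 # map Suc [0..<m]" for m
    by (simp add: map_Suc_upt upt_conv_Cons del: upt_Suc)
  have map: "map (\<lambda>i. (w i, w (Suc i))) [0..<Suc n]
      = (w 0, ?w 0) # map (\<lambda>i. (?w i, ?w (Suc i))) [0..<n]"
    by (simp add: upt o_def del: upt_Suc)
  have verts: "map w [0..<Suc (Suc n)] = w 0 # map ?w [0..<Suc n]"
    by (simp add: upt[of "Suc n"] o_def del: upt_Suc)
  show ?case
    unfolding map verts using IH arc Suc.prems(2) by (simp add: awalk_def)
qed

text \<open>
  A shortest segment with equal end vertices would be a cycle. Its length is at least three
  because there are no loops and no backtracking. Walks indexed by the integers suffice below:
  two rays with a common first vertex and different second vertices form one, and so does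
  an axis.
\<close>

lemma nonbacktracking_inj:
  fixes \<gamma> :: "int \<Rightarrow> 'v"
  assumes T: "is_tree T"
    and arc: "\<And>i. (\<gamma> i, \<gamma> (i + 1)) \<in> parcs T"
    and nb: "\<And>i. \<gamma> i \<noteq> \<gamma> (i + 2)"
  shows "inj \<gamma>"
proof (rule ccontr)
  interpret pair_bidirected_digraph T by (rule tree_pair_bidirected[OF T])
  assume "\<not> inj \<gamma>"
  then obtain a b where "a < b" "\<gamma> a = \<gamma> b"
    unfolding inj_def by (metis linorder_neqE)
  then have ex: "\<exists>n. 0 < n \<and> (\<exists>a. \<gamma> a = \<gamma> (a + int n))"
    by (intro exI[of _ "nat (b - a)"] conjI exI[of _ a]) auto
  define n where "n = (LEAST n. 0 < n \<and> (\<exists>a. \<gamma> a = \<gamma> (a + int n)))"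
  have "0 < n \<and> (\<exists>a. \<gamma> a = \<gamma> (a + int n))"
    unfolding n_def by (rule LeastI_ex[OF ex])
  then obtain a where "0 < n" and closed: "\<gamma> a = \<gamma> (a + int n)"
    by auto
  have minimal: "\<gamma> b \<noteq> \<gamma> (b + int m)" if "0 < m" "m < n" for b m
    using not_less_Least[of m "\<lambda>n. 0 < n \<and> (\<exists>a. \<gamma> a = \<gamma> (a + int n))"] that
    unfolding n_def by auto
  have "n \<noteq> 1"
    using closed tree_arc_neq[OF T arc[of a]] by auto
  moreover have "n \<noteq> 2"
    using closed nb[of a] by auto
  ultimately have "3 \<le> n"
    using \<open>0 < n\<close> by linarith
  define w where "w i = \<gamma> (a + int i)" for i
  define p where "p = map (\<lambda>i. (w i, w (Suc i))) [0..<n]"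
  have w_arc: "(w i, w (Suc i)) \<in> parcs T" for i
    using arc[of "a + int i"] by (simp add: w_def ac_simps)
  have walk: "awalk (w 0) p (w n)" and verts: "pawalk_verts (w 0) p = map w [0..<Suc n]"
    using awalk_of_sequence[of n w] w_arc tree_arc_in_verts[OF T w_arc[of 0]]
    by (simp_all add: p_def)
  have "inj_on w {1..<Suc n}"
  proof (rule linorder_inj_onI)
    fix i j :: nat
    assume "i < j" "i \<in> {1..<Suc n}" "j \<in> {1..<Suc n}"
    then show "w i \<noteq> w j"
      using minimal[of "j - i" "a + int i"] by (simp add: w_def of_nat_diff)
  qed auto
  moreover have "tl (map w [0..<Suc n]) = map w [1..<Suc n]"
    by (simp add: map_tl[symmetric] del: upt_Suc)
  ultimately have "distinct (tl (pawalk_verts (w 0) p))"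
    by (simp add: verts distinct_map del: upt_Suc)
  moreover have "w n = w 0"
    using closed by (simp add: w_def)
  ultimately have "cycle p"
    using walk \<open>3 \<le> n\<close> unfolding cycle_def by (auto simp: p_def)
  moreover have "3 \<le> length p"
    using \<open>3 \<le> n\<close> by (simp add: p_def)
  ultimately show False
    using T unfolding is_tree_def by blast
qed

section \<open>Rays and ends\<close>

lemma ray_shift: "ray T r \<Longrightarrow> ray T (\<lambda>i. r (i + n))"
  by (auto simp: ray_def inj_def) (metis add_right_cancel)

lemma ray_in_verts: "is_tree T \<Longrightarrow> ray T r \<Longrightarrow> r n \<in> pverts T"
  using tree_arc_in_verts unfolding ray_def by metis

lemma Aut_ray:
  assumes "is_tree T" "g \<in> carrier (Aut T)" "ray T r"
  shows "ray T (g \<circ> r)"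
proof -
  have "inj (g \<circ> r)"
    using assms(3) ray_in_verts[OF assms(1,3)] Aut_inj_on[OF assms(2)]
    by (intro comp_inj_on) (auto simp: ray_def intro: inj_on_subset)
  then show ?thesis
    using assms(3) Aut_arc[OF assms(1,2)] by (simp add: ray_def)
qed

text \<open>
  Uniqueness of paths in a tree, in the form needed for rays. After the common initial part is
  removed, the two rays leave the same vertex in different directions, so together they form a walk
  without backtracking; it is injective, and the rays do not meet again.
\<close>

lemma rays_meeting_agree:
  assumes T: "is_tree T"
    and "ray T r" "ray T s" "r 0 = s 0" "r m = s n"
  shows "m = n \<and> (\<forall>i\<le>m. r i = s i)"
  using assms(2-)
proof (induction m arbitrary: r s n)
  case 0
  then have "s 0 = s n"
    by simp
  then show ?case
    using 0 by (auto simp: ray_def inj_def)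
next
  case (Suc m)
  show ?case
  proof (cases "r 1 = s 1")
    case True
    have "n \<noteq> 0"
      using Suc.prems by (metis nat.distinct(1) injD ray_def)
    then obtain n' where n: "n = Suc n'"
      using not0_implies_Suc by auto
    have "m = n' \<and> (\<forall>i\<le>m. r (i + 1) = s (i + 1))"
      using Suc.IH[OF ray_shift[of T r 1] ray_shift[of T s 1], of n'] Suc.prems True n by simp
    moreover have "r i = s i" if "i \<le> Suc m" "\<forall>i\<le>m. r (i + 1) = s (i + 1)" for i
      using that Suc.prems(3) by (cases i) auto
    ultimately show ?thesis
      using n by simp
  next
    case False
    \<comment> \<open>The ray \<open>r\<close> traversed backwards, followed by \<open>s\<close>.\<close>
    define \<gamma> :: "int \<Rightarrow> 'a" where "\<gamma> i = (if 0 \<le> i then s (nat i) else r (nat (- i)))" for i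
    have "(\<gamma> i, \<gamma> (i + 1)) \<in> parcs T" for i
    proof (cases "0 \<le> i")
      case True
      then have "nat (i + 1) = Suc (nat i)"
        by simp
      then show ?thesis
        using True Suc.prems(2) by (simp add: \<gamma>_def ray_def)
    next
      case False
      define j where "j = nat (- i - 1)"
      have i: "i = - int (Suc j)"
        using False by (simp add: j_def)
      have "\<gamma> (i + 1) = r j"
        using Suc.prems(3) by (cases j) (auto simp: \<gamma>_def i nat_add_distrib)
      moreover have "\<gamma> i = r (Suc j)"
        by (simp add: \<gamma>_def i nat_add_distrib)
      ultimately show ?thesis
        using Suc.prems(1) tree_arc_sym[OF T] by (simp add: ray_def)
    qed
    moreover have "\<gamma> i \<noteq> \<gamma> (i + 2)" for i
    proof -
      consider "0 \<le> i" | "i = -1" | "i \<le> -2"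
        by linarith
      then show ?thesis
      proof cases
        case 1
        then show ?thesis
          using Suc.prems(2) by (auto simp: \<gamma>_def ray_def inj_eq)
      next
        case 2
        then show ?thesis
          using False by (simp add: \<gamma>_def)
      next
        case 3
        have "\<gamma> (i + 2) = r (nat (- (i + 2)))"
          using 3 Suc.prems(3) by (auto simp: \<gamma>_def)
        then show ?thesis
          using 3 Suc.prems(1) by (auto simp: \<gamma>_def ray_def inj_eq)
      qed
    qed
    ultimately have "inj \<gamma>"
      by (rule nonbacktracking_inj[OF T])
    moreover have "\<gamma> (- int (Suc m)) = \<gamma> (int n)"
      using Suc.prems(4) by (simp add: \<gamma>_def nat_add_distrib)
    ultimately have "- int (Suc m) = int n"
      by (rule injD)
    then show ?thesis
      by simp
  qed
qed

text \<open>
  In a tree two rays are equivalent if and only if they agree up to a shift from some point on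
  (\<open>ray_equiv_iff_same_tail\<close>). In this form the relation is visibly transitive.
\<close>

definition same_tail :: "(nat \<Rightarrow> 'v) \<Rightarrow> (nat \<Rightarrow> 'v) \<Rightarrow> bool" where
  "same_tail r s \<longleftrightarrow> (\<exists>m n. \<forall>i. r (i + m) = s (i + n))"

lemma same_tail_sym: "same_tail r s \<Longrightarrow> same_tail s r"
  unfolding same_tail_def by metis

lemma same_tail_trans:
  assumes "same_tail r s" "same_tail s t"
  shows "same_tail r t"
proof -
  obtain a b c d where ab: "\<And>i. r (i + a) = s (i + b)" and cd: "\<And>i. s (i + c) = t (i + d)"
    using assms unfolding same_tail_def by metis
  have "r (i + (a + c)) = t (i + (b + d))" for i
    using ab[of "i + c"] cd[of "i + b"] by (simp add: ac_simps)
  then show ?thesis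
    unfolding same_tail_def by blast
qed

text \<open>
  Between a common vertex and any later common vertex the two rays run along the same path, and
  there are common vertices that come arbitrarily late on both rays.
\<close>

lemma same_tail_if_infinite_meet:
  assumes T: "is_tree T" and r: "ray T r" and s: "ray T s"
    and inf: "infinite (range r \<inter> range s)"
  shows "same_tail r s"
proof -
  have later: "\<exists>m n. m0 < m \<and> n0 < n \<and> r m = s n" for m0 n0
  proof -
    have "infinite (range r \<inter> range s - (r ` {..m0} \<union> s ` {..n0}))"
      using inf by (intro Diff_infinite_finite) auto
    then obtain x where "x \<in> range r \<inter> range s - (r ` {..m0} \<union> s ` {..n0})"
      using infinite_imp_nonempty by blast
    then obtain m n where "x = r m" "x = s n" "m \<notin> {..m0}" "n \<notin> {..n0}"
      by blast
    then show ?thesis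
      by (metis atMost_iff not_le)
  qed
  obtain m0 n0 where eq0: "r m0 = s n0"
    using later[of 0 0] by auto
  have "r (i + m0) = s (i + n0)" for i
  proof -
    obtain m n where mn: "m0 + i < m" "n0 < n" "r m = s n"
      using later by blast
    have "m - m0 = n - n0 \<and> (\<forall>j\<le>m - m0. r (j + m0) = s (j + n0))"
      (is "_ \<and> ?agree")
      using rays_meeting_agree[OF T ray_shift[OF r, of m0] ray_shift[OF s, of n0],
          of "m - m0" "n - n0"] eq0 mn
      by simp
    then have ?agree ..
    moreover have "i \<le> m - m0"
      using mn(1) by linarith
    ultimately show ?thesis
      by blast
  qed
  then show ?thesis
    unfolding same_tail_def by blast
qed

lemma ray_equiv_iff_same_tail:
  assumes T: "is_tree T"
  shows "(r, s) \<in> ray_equiv T \<longleftrightarrow> ray T r \<and> ray T s \<and> same_tail r s"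
proof
  assume "(r, s) \<in> ray_equiv T"
  then obtain t where "ray T r" "ray T s" "ray T t"
    "infinite (range t \<inter> range r)" "infinite (range t \<inter> range s)"
    by (auto simp: ray_equiv_def)
  then show "ray T r \<and> ray T s \<and> same_tail r s"
    using same_tail_if_infinite_meet[OF T] same_tail_sym same_tail_trans by blast
next
  assume rs: "ray T r \<and> ray T s \<and> same_tail r s"
  then obtain m n where eq: "\<And>i. r (i + m) = s (i + n)"
    unfolding same_tail_def by blast
  let ?t = "\<lambda>i. r (i + m)"
  have t: "ray T ?t"
    using rs ray_shift by blast
  then have "infinite (range ?t)"
    by (simp add: ray_def range_inj_infinite)
  moreover have "range ?t \<inter> range r = range ?t" "range ?t \<inter> range s = range ?t"
    using eq by auto (metis rangeI)+
  ultimately show "(r, s) \<in> ray_equiv T"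
    using rs t unfolding ray_equiv_def by (smt (verit) case_prodI mem_Collect_eq)
qed

lemma end_ray: "is_tree T \<Longrightarrow> \<epsilon> \<in> ends T \<Longrightarrow> r \<in> \<epsilon> \<Longrightarrow> ray T r"
  by (auto simp: ends_def quotient_def ray_equiv_iff_same_tail)

lemma end_mem_iff_same_tail:
  assumes "is_tree T" "\<epsilon> \<in> ends T" "r \<in> \<epsilon>"
  shows "s \<in> \<epsilon> \<longleftrightarrow> ray T s \<and> same_tail r s"
proof -
  obtain r0 where "\<epsilon> = ray_equiv T `` {r0}"
    using assms(2) by (auto simp: ends_def quotient_def)
  then show ?thesis
    using assms(1,3) same_tail_sym same_tail_trans
    by (auto simp: ray_equiv_iff_same_tail) blast+
qed

lemma end_shift:
  assumes "is_tree T" "\<epsilon> \<in> ends T" "r \<in> \<epsilon>"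
  shows "(\<lambda>i. r (i + n)) \<in> \<epsilon>"
proof -
  have "same_tail r (\<lambda>i. r (i + n))"
    unfolding same_tail_def by (rule exI[of _ n], rule exI[of _ 0]) simp
  then show ?thesis
    using assms end_mem_iff_same_tail end_ray ray_shift by blast
qed

text \<open>
  A common tail of the rays is a common vertex as late as desired, and up to it the rays agree by
  uniqueness of paths.
\<close>

lemma end_ray_unique:
  assumes T: "is_tree T" and \<epsilon>: "\<epsilon> \<in> ends T" and "r \<in> \<epsilon>" "s \<in> \<epsilon>" "r 0 = s 0"
  shows "r = s"
proof
  fix i
  have rays: "ray T r" "ray T s"
    using assms end_ray by blast+
  obtain m n where eq: "\<And>i. r (i + m) = s (i + n)"
    using assms end_mem_iff_same_tail same_tail_def by metis
  show "r i = s i"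
    using rays_meeting_agree[OF T rays assms(5) eq[of i]] by simp
qed

section \<open>Ends fixed by a group are fixed by its closures\<close>

lemma subset_gball_arc:
  assumes T: "is_tree T" and "(u, v) \<in> parcs T" "1 \<le> k"
  shows "{u, v} \<subseteq> gball T u k"
proof -
  interpret pair_bidirected_digraph T by (rule tree_pair_bidirected[OF T])
  have "awalk u [] u" "awalk u [(u, v)] v"
    using tree_arc_in_verts[OF T assms(2)] assms(2) by (simp_all add: awalk_def)
  then show ?thesis
    using assms(3) unfolding gball_def by force
qed

lemma Pk_closure_agree_on_arc:
  assumes "is_tree T" "1 \<le> k" "h \<in> Pk_closure T k G" "(u, v) \<in> parcs T"
  shows "\<exists>g\<in>G. g u = h u \<and> g v = h v"
proof -
  have "\<exists>g\<in>G. \<forall>x\<in>{u, v}. g x = h x"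
    using assms(3) subset_gball_arc[OF assms(1,4,2)] tree_arc_in_verts[OF assms(1,4)]
    unfolding Pk_closure_def by blast
  then show ?thesis
    by simp
qed

lemma fixes_end_image:
  "fixes_end G \<epsilon> \<Longrightarrow> g \<in> G \<Longrightarrow> r \<in> \<epsilon> \<Longrightarrow> g \<circ> r \<in> \<epsilon>"
  by (auto simp: fixes_end_def)

text \<open>
  By induction along the ray. If \<open>h\<close> and \<open>g\<close> agree at a vertex, take an element \<open>g'\<close> of \<open>G\<close> that
  agrees with \<open>h\<close> there and at the next vertex. Both \<open>g\<close> and \<open>g'\<close> map the remaining ray to a ray
  of the fixed end, with the same first vertex; hence the images are equal.
\<close>

lemma fixed_end_ray_image_eq:
  assumes T: "is_tree T" and k: "1 \<le> k" and \<epsilon>: "\<epsilon> \<in> ends T" "fixes_end G \<epsilon>"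
    and h: "h \<in> Pk_closure T k G" and r: "r \<in> \<epsilon>"
    and g: "g \<in> G" "g (r 0) = h (r 0)"
  shows "h \<circ> r = g \<circ> r"
proof
  fix n
  have "h (r n) = g (r n)"
  proof (induction n)
    case 0
    show ?case
      using g by simp
  next
    case (Suc n)
    have "(r n, r (Suc n)) \<in> parcs T"
      using end_ray[OF T \<epsilon>(1) r] by (simp add: ray_def)
    then obtain g' where g': "g' \<in> G" "g' (r n) = h (r n)" "g' (r (Suc n)) = h (r (Suc n))"
      using Pk_closure_agree_on_arc[OF T k h] by metis
    let ?s = "\<lambda>i. r (i + n)"
    have "?s \<in> \<epsilon>"
      by (rule end_shift[OF T \<epsilon>(1) r])
    then have "g' \<circ> ?s \<in> \<epsilon>" "g \<circ> ?s \<in> \<epsilon>"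
      using fixes_end_image[OF \<epsilon>(2)] g g' by blast+
    moreover have "(g' \<circ> ?s) 0 = (g \<circ> ?s) 0"
      using g' Suc by simp
    ultimately have "g' \<circ> ?s = g \<circ> ?s"
      by (rule end_ray_unique[OF T \<epsilon>(1)])
    then have "g' (r (Suc n)) = g (r (Suc n))"
      by (auto dest: fun_cong[of _ _ 1])
    then show ?case
      using g' by simp
  qed
  then show "(h \<circ> r) n = (g \<circ> r) n"
    by simp
qed

lemma fixes_end_Pk_closure:
  assumes T: "is_tree T" and G: "subgroup G (Aut T)" and k: "1 \<le> k"
    and \<epsilon>: "\<epsilon> \<in> ends T" "fixes_end G \<epsilon>"
  shows "fixes_end (Pk_closure T k G) \<epsilon>"
  unfolding fixes_end_def
proof
  fix h assume h: "h \<in> Pk_closure T k G"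
  then have hA: "h \<in> carrier (Aut T)"
    by (simp add: Pk_closure_def)
  have agree: "\<exists>g\<in>G. g (r 0) = h (r 0)" if "ray T r" for r
    using Pk_closure_agree_on_arc[OF T k h] that unfolding ray_def by metis
  have into: "h \<circ> r \<in> \<epsilon>" if r: "r \<in> \<epsilon>" for r
  proof -
    obtain g where g: "g \<in> G" "g (r 0) = h (r 0)"
      using agree end_ray[OF T \<epsilon>(1) r] by blast
    show ?thesis
      using fixed_end_ray_image_eq[OF T k \<epsilon> h r g] fixes_end_image[OF \<epsilon>(2) g(1) r] by simp
  qed
  \<comment> \<open>The preimage of \<open>r\<close> under \<open>h\<close> is the preimage under an element \<open>g\<close> of \<open>G\<close> that agrees with
    \<open>h\<close> at its first vertex, and the latter lies in the end.\<close>
  have onto: "r \<in> (\<lambda>r. h \<circ> r) ` \<epsilon>" if r: "r \<in> \<epsilon>" for r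
  proof -
    interpret A: group "Aut T" by (rule group_Aut)
    have ray: "ray T r"
      by (rule end_ray[OF T \<epsilon>(1) r])
    let ?s = "(inv\<^bsub>Aut T\<^esub> h) \<circ> r"
    have s: "ray T ?s"
      by (rule Aut_ray[OF T _ ray]) (simp add: hA)
    then obtain g where g: "g \<in> G" "g (?s 0) = h (?s 0)"
      using agree by blast
    have gA: "g \<in> carrier (Aut T)"
      using G g(1) subgroup.subset by blast
    have hs: "h (?s 0) = r 0"
      using Aut_inv_apply(2)[OF hA ray_in_verts[OF T ray]] by simp
    let ?t = "(inv\<^bsub>Aut T\<^esub> g) \<circ> r"
    have "inv\<^bsub>Aut T\<^esub> g \<in> G"
      by (rule subgroup.m_inv_closed[OF G g(1)])
    then have t: "?t \<in> \<epsilon>"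
      using fixes_end_image[OF \<epsilon>(2) _ r] by blast
    have "?t 0 = (inv\<^bsub>Aut T\<^esub> g) (g (?s 0))"
      using hs g by simp
    also have "\<dots> = ?s 0"
      by (rule Aut_inv_apply(1)[OF gA ray_in_verts[OF T s]])
    finally have "(h \<circ> ?t) 0 = r 0"
      using hs by simp
    then have "h \<circ> ?t = r"
      using end_ray_unique[OF T \<epsilon>(1) into[OF t] r] by simp
    then show ?thesis
      using t by (metis image_eqI)
  qed
  show "(\<lambda>r. h \<circ> r) ` \<epsilon> = \<epsilon>"
    using into onto by blast
qed

section \<open>Translations\<close>

text \<open>
  The line \<open>\<delta>\<close> consists of the images of the segment of \<open>\<gamma>\<close> from \<open>0\<close> to \<open>l\<close> under the powers of
  \<open>g\<close>. Consecutive images share a vertex since \<open>g (\<gamma> 0) = \<gamma> l\<close>. There is no backtracking at this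
  vertex since \<open>g (\<gamma> 1) = \<gamma> (l + 1)\<close>. Injectivity follows from these local conditions.
\<close>

lemma translation_from_agreeing_arc:
  fixes \<gamma> :: "int \<Rightarrow> 'v" and l :: int
  assumes T: "is_tree T" and \<gamma>: "line T \<gamma>" and l: "0 < l" and g: "g \<in> carrier (Aut T)"
    and g0: "g (\<gamma> 0) = \<gamma> l" and g1: "g (\<gamma> 1) = \<gamma> (l + 1)"
  obtains \<delta> where "line T \<delta>" "\<And>i. g (\<delta> i) = \<delta> (i + l)" "\<And>i. 0 \<le> i \<Longrightarrow> i < l \<Longrightarrow> \<delta> i = \<gamma> i"
proof -
  interpret A: group "Aut T" by (rule group_Aut)
  define pow where "pow q = g [^]\<^bsub>Aut T\<^esub> q" for q :: int
  have pow: "pow q \<in> carrier (Aut T)" for q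
    using g by (simp add: pow_def A.int_pow_closed)
  have arc: "(\<gamma> i, \<gamma> (i + 1)) \<in> parcs T" for i
    using \<gamma> by (simp add: line_def)
  have vert: "\<gamma> i \<in> pverts T" for i
    using tree_arc_in_verts(1)[OF T arc] .
  have pow_1: "pow 1 = g"
    using g by (simp add: pow_def)
  have pow_add: "pow (p + q) x = pow p (pow q x)" if "x \<in> pverts T" for p q x
    using g that Aut_mult_apply[OF pow pow] by (simp add: pow_def A.int_pow_mult)
  have pow_0: "pow 0 x = x" if "x \<in> pverts T" for x
    using that by (simp add: pow_def Aut_one_apply)
  define \<delta> where "\<delta> j = pow (j div l) (\<gamma> (j mod l))" for j
  have base: "\<delta> (q * l + i) = pow q (\<gamma> i)" if "0 \<le> i" "i < l" for q i
    using that l by (simp add: \<delta>_def)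
  have step: "pow (q + 1) (\<gamma> i) = pow q (\<gamma> (i + l))" if "i = 0 \<or> i = 1" for q i
    using that g0 g1 pow_add[OF vert, of q 1] by (auto simp: pow_1 add.commute)
  \<comment> \<open>The bound \<open>l + 1\<close> makes every three consecutive vertices of \<open>\<delta>\<close> the image of three
    consecutive vertices of \<open>\<gamma>\<close> under one power of \<open>g\<close>.\<close>
  have window: "\<delta> (q * l + i) = pow q (\<gamma> i)" if i: "0 \<le> i" "i \<le> l + 1" for q i
  proof (cases "i < l")
    case True
    then show ?thesis
      using base i by simp
  next
    case False
    then consider "i = l" | "i = l + 1"
      using i by linarith
    then show ?thesis
    proof cases
      case 1
      then show ?thesis
        using base[of 0 "q + 1"] step[of 0 q] l by (simp add: algebra_simps)
    next
      case 2
      show ?thesis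
      proof (cases "l = 1")
        \<comment> \<open>The vertex \<open>\<gamma> 1\<close> is already outside the segment that represents the residues
          modulo \<open>l\<close>, so two steps are needed.\<close>
        case True
        then have "\<delta> (q * l + i) = pow (q + 1 + 1) (\<gamma> 0)"
          using base[of 0 "q + 2"] 2 l by (simp add: algebra_simps)
        then show ?thesis
          using step[of 0 "q + 1"] step[of 1 q] True 2 by simp
      next
        case False
        then have "\<delta> (q * l + i) = pow (q + 1) (\<gamma> 1)"
          using base[of 1 "q + 1"] 2 l by (simp add: algebra_simps)
        then show ?thesis
          using step[of 1 q] 2 by (simp add: add.commute)
      qed
    qed
  qed
  have local: "\<exists>q i. \<delta> j = pow q (\<gamma> i) \<and> \<delta> (j + 1) = pow q (\<gamma> (i + 1))
      \<and> \<delta> (j + 2) = pow q (\<gamma> (i + 2))" for j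
  proof -
    define q where "q = j div l"
    define i where "i = j mod l"
    have j: "j = q * l + i" and i: "0 \<le> i" "i < l"
      using l by (simp_all add: q_def i_def)
    show ?thesis
      using window[of i q] window[of "i + 1" q] window[of "i + 2" q] i
      unfolding j by (intro exI[of _ q] exI[of _ i]) (simp add: add.assoc)
  qed
  have "inj \<delta>"
  proof (rule nonbacktracking_inj[OF T])
    fix j
    obtain q i where *: "\<delta> j = pow q (\<gamma> i)" "\<delta> (j + 1) = pow q (\<gamma> (i + 1))"
        "\<delta> (j + 2) = pow q (\<gamma> (i + 2))"
      using local by blast
    show "(\<delta> j, \<delta> (j + 1)) \<in> parcs T"
      unfolding * by (rule Aut_arc[OF T pow arc])
    have "\<gamma> i \<noteq> \<gamma> (i + 2)"
      using \<gamma> by (auto simp: line_def inj_eq)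
    then show "\<delta> j \<noteq> \<delta> (j + 2)"
      unfolding * using Aut_inj_on[OF pow] vert by (metis inj_onD)
  qed
  moreover have "(\<delta> j, \<delta> (j + 1)) \<in> parcs T" for j
    using local[of j] Aut_arc[OF T pow arc] by metis
  ultimately have "line T \<delta>"
    by (simp add: line_def)
  moreover have "g (\<delta> j) = \<delta> (j + l)" for j
    using pow_add[OF vert, of 1 "j div l"] l by (simp add: \<delta>_def pow_1 add.commute)
  moreover have "\<delta> i = \<gamma> i" if "0 \<le> i" "i < l" for i
    using base[OF that, of 0] pow_0[OF vert] by simp
  ultimately show ?thesis
    by (rule that)
qed

lemma translates_line_agree:
  assumes T: "is_tree T" and k: "1 \<le> k" and h: "h \<in> Pk_closure T k G"
    and tr: "translates_line T h \<gamma>"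
  obtains g l where "g \<in> G" "0 < l" "\<And>i. h (\<gamma> i) = \<gamma> (i + l)"
    "g (\<gamma> 0) = \<gamma> l" "g (\<gamma> 1) = \<gamma> (l + 1)"
proof -
  obtain l where l: "0 < l" "\<And>i. h (\<gamma> i) = \<gamma> (i + l)" and line: "line T \<gamma>"
    using tr by (auto simp: translates_line_def)
  have "(\<gamma> 0, \<gamma> 1) \<in> parcs T"
    using line by (metis add_0 line_def)
  then obtain g where "g \<in> G" "g (\<gamma> 0) = h (\<gamma> 0)" "g (\<gamma> 1) = h (\<gamma> 1)"
    using Pk_closure_agree_on_arc[OF T k h] by metis
  then show ?thesis
    using that l by (simp add: add.commute)
qed

lemma translation_Pk_closure:
  assumes T: "is_tree T" and G: "subgroup G (Aut T)" and k: "1 \<le> k"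
    and h: "h \<in> Pk_closure T k G" and tr: "translation T h"
  shows "\<exists>g\<in>G. translation T g"
proof -
  obtain \<gamma> where \<gamma>: "translates_line T h \<gamma>"
    using tr by (auto simp: translation_def)
  then obtain g l where g: "g \<in> G" "0 < l" "g (\<gamma> 0) = \<gamma> l" "g (\<gamma> 1) = \<gamma> (l + 1)"
    by (rule translates_line_agree[OF T k h])
  have "line T \<gamma>" "g \<in> carrier (Aut T)"
    using \<gamma> G g(1) subgroup.subset by (auto simp: translates_line_def)
  then obtain \<delta> where "line T \<delta>" "\<And>i. g (\<delta> i) = \<delta> (i + l)"
    using translation_from_agreeing_arc[OF T _ g(2) _ g(3,4)] by metis
  then show ?thesis
    using g by (auto simp: translation_def translates_line_def)
qed

lemma fixed_end_line_image:
  assumes T: "is_tree T" and k: "1 \<le> k" and \<epsilon>: "\<epsilon> \<in> ends T" "fixes_end G \<epsilon>"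
    and h: "h \<in> Pk_closure T k G" and g: "g \<in> G" "g (\<gamma> 0) = h (\<gamma> 0)"
    and hl: "\<And>i. h (\<gamma> i) = \<gamma> (i + l)"
  shows "(\<lambda>n. \<gamma> (int n)) \<in> \<epsilon> \<Longrightarrow> 0 \<le> i \<Longrightarrow> g (\<gamma> i) = \<gamma> (i + l)"
    and "(\<lambda>n. \<gamma> (- int n)) \<in> \<epsilon> \<Longrightarrow> i \<le> 0 \<Longrightarrow> g (\<gamma> i) = \<gamma> (i + l)"
proof -
  assume "(\<lambda>n. \<gamma> (int n)) \<in> \<epsilon>" "0 \<le> i"
  then show "g (\<gamma> i) = \<gamma> (i + l)"
    using fun_cong[OF fixed_end_ray_image_eq[OF T k \<epsilon> h, of "\<lambda>n. \<gamma> (int n)" g], of "nat i"] g hl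
    by simp
next
  assume "(\<lambda>n. \<gamma> (- int n)) \<in> \<epsilon>" "i \<le> 0"
  then show "g (\<gamma> i) = \<gamma> (i + l)"
    using fun_cong[OF fixed_end_ray_image_eq[OF T k \<epsilon> h, of "\<lambda>n. \<gamma> (- int n)" g], of "nat (- i)"]
      g hl
    by simp
qed

text \<open>
  The axis of \<open>g\<close> obtained from an edge of the axis \<open>\<gamma>\<close> of \<open>h\<close> need not be \<open>\<gamma>\<close>. But \<open>g\<close> acts like
  \<open>h\<close> on the part of \<open>\<gamma>\<close> that leads to the fixed end, so the two axes agree on this part.
\<close>

lemma translation_towards_Pk_closure:
  assumes T: "is_tree T" and G: "subgroup G (Aut T)" and k: "1 \<le> k"
    and \<epsilon>: "\<epsilon> \<in> ends T" "fixes_end G \<epsilon>"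
    and h: "h \<in> Pk_closure T k G" and tr: "translation_towards T h \<epsilon>"
  shows "\<exists>g\<in>G. translation_towards T g \<epsilon>"
proof -
  obtain \<gamma> where \<gamma>: "translates_line T h \<gamma>" "(\<lambda>n. \<gamma> (int n)) \<in> \<epsilon>"
    using tr by (auto simp: translation_towards_def)
  obtain g l where g: "g \<in> G" "0 < l" "\<And>i. h (\<gamma> i) = \<gamma> (i + l)"
      "g (\<gamma> 0) = \<gamma> l" "g (\<gamma> 1) = \<gamma> (l + 1)"
    using translates_line_agree[OF T k h \<gamma>(1)] by metis
  have "line T \<gamma>" "g \<in> carrier (Aut T)"
    using \<gamma> G g(1) subgroup.subset by (auto simp: translates_line_def)
  then obtain \<delta> where \<delta>: "line T \<delta>" "\<And>i. g (\<delta> i) = \<delta> (i + l)"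
      "\<And>i. 0 \<le> i \<Longrightarrow> i < l \<Longrightarrow> \<delta> i = \<gamma> i"
    using translation_from_agreeing_arc[OF T _ g(2) _ g(4,5)] by metis
  have forward: "g (\<gamma> i) = \<gamma> (i + l)" if "0 \<le> i" for i
    using fixed_end_line_image(1)[OF T k \<epsilon> h g(1) _ g(3) \<gamma>(2) that] g(3)[of 0] g(4) by simp
  have "\<delta> (int n) = \<gamma> (int n)" for n
  proof (induction n rule: less_induct)
    case (less n)
    show ?case
    proof (cases "int n < l")
      case True
      then show ?thesis
        using \<delta>(3) by simp
    next
      case False
      define m where "m = n - nat l"
      have m: "m < n" "int n = int m + l"
        using False g(2) by (auto simp: m_def)
      then show ?thesis
        using less[OF m(1)] \<delta>(2)[of "int m"] forward[of "int m"] by simp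
    qed
  qed
  then have "(\<lambda>n. \<delta> (int n)) \<in> \<epsilon>"
    using \<gamma>(2) by simp
  then show ?thesis
    using \<delta>(1,2) g(1,2) by (auto simp: translation_towards_def translates_line_def)
qed

lemma translates_line_between_Pk_closure:
  assumes T: "is_tree T" and k: "1 \<le> k"
    and \<epsilon>: "\<epsilon> \<in> ends T" "fixes_end G \<epsilon>" and \<omega>: "\<omega> \<in> ends T" "fixes_end G \<omega>"
    and \<gamma>: "line_between T \<gamma> \<epsilon> \<omega>"
    and h: "h \<in> Pk_closure T k G" and tr: "translates_line T h \<gamma>"
  shows "\<exists>g\<in>G. translates_line T g \<gamma>"
proof -
  obtain g l where g: "g \<in> G" "0 < l" "\<And>i. h (\<gamma> i) = \<gamma> (i + l)" "g (\<gamma> 0) = \<gamma> l"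
    using translates_line_agree[OF T k h tr] by metis
  have g0: "g (\<gamma> 0) = h (\<gamma> 0)"
    using g(3)[of 0] g(4) by simp
  have "g (\<gamma> i) = \<gamma> (i + l)" for i
    using fixed_end_line_image(1)[OF T k \<omega> h g(1) g0 g(3), of i]
      fixed_end_line_image(2)[OF T k \<epsilon> h g(1) g0 g(3), of i] \<gamma>
    by (cases "0 \<le> i") (auto simp: line_between_def)
  then show ?thesis
    using g(1,2) \<gamma> by (auto simp: translates_line_def line_between_def)
qed

section \<open>The type of a group between a group and its closure\<close>

lemma Pk_closure_agree_on_subset:
  assumes "h \<in> Pk_closure T k G" "v \<in> pverts T" "X \<subseteq> gball T v k" "finite X"
  shows "\<exists>g\<in>G. \<forall>x\<in>X. g x = h x"
  using assms unfolding Pk_closure_def by blast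

text \<open>
  In each existence or fixing condition one direction is monotonicity in the set of automorphisms;
  the other one comes from the agreement of elements of the closure with elements of the group.
  A focal or lineal type involves its ends in the condition on translations, so the sets of fixed
  ends are compared first.
\<close>

lemma has_type_intermediate:
  assumes T: "is_tree T" and G: "subgroup G (Aut T)" and k: "1 \<le> k"
    and GH: "G \<subseteq> H" and HP: "H \<subseteq> Pk_closure T k G"
  shows "has_type T G \<tau> \<longleftrightarrow> has_type T H \<tau>"
proof -
  have vertex: "fixes_vertex G v \<longleftrightarrow> fixes_vertex H v" if "v \<in> pverts T" for v
  proof
    interpret pair_bidirected_digraph T by (rule tree_pair_bidirected[OF T])
    assume fix_v: "fixes_vertex G v"
    have "{v} \<subseteq> gball T v k"
      using that by (auto simp: gball_def awalk_def intro!: exI[of _ "[]"])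
    then have "\<exists>g\<in>G. \<forall>x\<in>{v}. g x = h x" if "h \<in> H" for h
      using Pk_closure_agree_on_subset[of h T k G v "{v}"] HP that \<open>v \<in> pverts T\<close> by blast
    then show "fixes_vertex H v"
      using fix_v unfolding fixes_vertex_def by (metis singletonI)
  next
    show "fixes_vertex H v \<Longrightarrow> fixes_vertex G v"
      using GH by (auto simp: fixes_vertex_def)
  qed
  have edge_agree: "\<exists>g\<in>G. \<forall>x\<in>e. g x = h x" if "e \<in> edges T" "h \<in> H" for e h
    using Pk_closure_agree_on_arc[OF T k, of h G] HP that by (fastforce simp: edges_def)
  have edge: "preserves_edge G e \<longleftrightarrow> preserves_edge H e" if e: "e \<in> edges T" for e
  proof
    assume pres: "preserves_edge G e"
    show "preserves_edge H e"
      unfolding preserves_edge_def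
    proof
      fix h assume "h \<in> H"
      then obtain g where "g \<in> G" "\<forall>x\<in>e. g x = h x"
        using edge_agree[OF e] by blast
      then show "h ` e = e"
        using pres unfolding preserves_edge_def by (metis image_cong)
    qed
  next
    show "preserves_edge H e \<Longrightarrow> preserves_edge G e"
      using GH by (auto simp: preserves_edge_def)
  qed
  then have fixed_edges: "{e \<in> edges T. preserves_edge G e} = {e \<in> edges T. preserves_edge H e}"
    by blast
  have inversion: "(\<exists>g\<in>G. inverts_edge g e) \<longleftrightarrow> (\<exists>h\<in>H. inverts_edge h e)"
    if e: "e \<in> edges T" for e
  proof
    assume "\<exists>h\<in>H. inverts_edge h e"
    then obtain h where h: "h \<in> H" "inverts_edge h e"
      by blast
    then obtain g where "g \<in> G" "\<forall>x\<in>e. g x = h x"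
      using edge_agree[OF e] by blast
    then show "\<exists>g\<in>G. inverts_edge g e"
      using h(2) unfolding inverts_edge_def by (metis insertI1 insertI2)
  qed (use GH in blast)
  have end_iff: "fixes_end G \<epsilon> \<longleftrightarrow> fixes_end H \<epsilon>" if "\<epsilon> \<in> ends T" for \<epsilon>
    using fixes_end_Pk_closure[OF T G k that] GH HP unfolding fixes_end_def by blast
  then have fixed_ends: "{\<epsilon> \<in> ends T. fixes_end G \<epsilon>} = {\<epsilon> \<in> ends T. fixes_end H \<epsilon>}"
    by blast
  have translation: "(\<exists>g\<in>G. translation T g) \<longleftrightarrow> (\<exists>h\<in>H. translation T h)"
    using translation_Pk_closure[OF T G k] GH HP by blast
  show ?thesis
  proof (cases \<tau>)
    case Fixed_Vertex
    then show ?thesis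
      using vertex by auto
  next
    case Inversion
    have iff: "(\<exists>g\<in>G. inverts_edge g e) \<longleftrightarrow> (\<exists>h\<in>H. inverts_edge h e)"
      if "{e' \<in> edges T. preserves_edge H e'} = {e}" for e
      using inversion that by blast
    show ?thesis
      unfolding Inversion has_type.simps fixed_edges by (intro ex_cong1 conj_cong refl) (rule iff)
  next
    case Lineal
    have iff: "(\<exists>g\<in>G. translates_line T g \<gamma>) \<longleftrightarrow> (\<exists>h\<in>H. translates_line T h \<gamma>)"
      if ends: "{\<eta> \<in> ends T. fixes_end H \<eta>} = {\<epsilon>, \<omega>}" and \<gamma>: "line_between T \<gamma> \<epsilon> \<omega>"
      for \<epsilon> \<omega> \<gamma>
    proof -
      have "\<epsilon> \<in> ends T" "fixes_end G \<epsilon>" "\<omega> \<in> ends T" "fixes_end G \<omega>"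
        using ends fixed_ends by blast+
      from translates_line_between_Pk_closure[OF T k this \<gamma>] show ?thesis
        using GH HP by (meson subsetD)
    qed
    show ?thesis
      unfolding Lineal has_type.simps fixed_ends by (intro ex_cong1 conj_cong refl) (rule iff)
  next
    case Focal
    have iff: "(\<exists>g\<in>G. translation_towards T g \<epsilon>) \<longleftrightarrow> (\<exists>h\<in>H. translation_towards T h \<epsilon>)"
      if ends: "{\<eta> \<in> ends T. fixes_end H \<eta>} = {\<epsilon>}" for \<epsilon>
    proof -
      have "\<epsilon> \<in> ends T" "fixes_end G \<epsilon>"
        using ends fixed_ends by blast+
      from translation_towards_Pk_closure[OF T G k this] show ?thesis
        using GH HP by (meson subsetD)
    qed
    show ?thesis
      unfolding Focal has_type.simps fixed_ends by (intro ex_cong1 conj_cong refl) (rule iff)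
  next
    case Horocyclic
    then show ?thesis
      using vertex translation by (simp add: fixed_ends)
  next
    case General
    then show ?thesis
      using end_iff translation by auto
  qed
qed

lemma Aut_mem_coset_pointwise_stab:
  assumes "h \<in> carrier (Aut T)" "X \<subseteq> pverts T"
  shows "h \<in> h <#\<^bsub>Aut T\<^esub> pointwise_stab T X"
proof -
  interpret A: group "Aut T" by (rule group_Aut)
  have "\<one>\<^bsub>Aut T\<^esub> \<in> pointwise_stab T X"
    using assms by (auto simp: pointwise_stab_def Aut_one_apply)
  then show ?thesis
    using assms by (force simp: l_coset_def)
qed

lemma topspace_perm_topology: "topspace (perm_topology T) = carrier (Aut T)"
proof -
  interpret A: group "Aut T" by (rule group_Aut)
  have "f <#\<^bsub>Aut T\<^esub> pointwise_stab T X \<subseteq> carrier (Aut T)" if "f \<in> carrier (Aut T)" for f X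
    using that by (auto simp: l_coset_def pointwise_stab_def)
  moreover have "h \<in> h <#\<^bsub>Aut T\<^esub> pointwise_stab T {}" if "h \<in> carrier (Aut T)" for h
    using Aut_mem_coset_pointwise_stab[OF that] by simp
  ultimately show ?thesis
    unfolding perm_topology_def topology_generated_by_topspace by blast
qed

text \<open>
  A neighbourhood \<open>h <#\<^bsub>Aut T\<^esub> pointwise_stab T X\<close> of \<open>h\<close> consists of the automorphisms that agree
  with \<open>h\<close> on \<open>X\<close>, so an element of the topological closure satisfies the condition of
  the other closure for all finite sets of vertices, not only for those within a ball.
\<close>

lemma closure_of_subset_Pk_closure:
  assumes T: "is_tree T" and G: "G \<subseteq> carrier (Aut T)"
  shows "perm_topology T closure_of G \<subseteq> Pk_closure T k G"
proof
  fix h assume h: "h \<in> perm_topology T closure_of G"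
  then have hA: "h \<in> carrier (Aut T)"
    by (simp add: in_closure_of topspace_perm_topology)
  have "\<exists>g\<in>G. \<forall>x\<in>X. g x = h x" if X: "X \<subseteq> pverts T" "finite X" for X
  proof -
    let ?U = "h <#\<^bsub>Aut T\<^esub> pointwise_stab T X"
    have "openin (perm_topology T) ?U"
      unfolding perm_topology_def using hA X by (intro topology_generated_by_Basis) blast
    moreover have "h \<in> ?U"
      by (rule Aut_mem_coset_pointwise_stab[OF hA X(1)])
    ultimately obtain g where g: "g \<in> G" "g \<in> ?U"
      using h by (auto simp: in_closure_of)
    then obtain f where f: "f \<in> pointwise_stab T X" "g = h \<otimes>\<^bsub>Aut T\<^esub> f"
      by (auto simp: l_coset_def)
    have "g x = h x" if "x \<in> X" for x
      using f that X(1) Aut_mult_apply[OF hA, of f x] by (auto simp: pointwise_stab_def)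
    then show ?thesis
      using g(1) by blast
  qed
  moreover have "gball T v k \<subseteq> pverts T" for v
  proof -
    interpret pair_bidirected_digraph T by (rule tree_pair_bidirected[OF T])
    show ?thesis
      by (auto simp: gball_def)
  qed
  ultimately show "h \<in> Pk_closure T k G"
    using hA unfolding Pk_closure_def by blast
qed

theorem proposition2p4:
  fixes T :: "'v pair_pre_digraph" and G :: "('v \<Rightarrow> 'v) set" and k :: nat
  assumes "is_tree T"
    and "subgroup G (Aut T)"
    and "1 \<le> k"
  shows "Type T G = Type T (perm_topology T closure_of G) \<and>
         Type T (perm_topology T closure_of G) = Type T (Pk_closure T k G) \<and>
         (\<forall>\<tau>. (has_type T G \<tau> \<longleftrightarrow> has_type T (perm_topology T closure_of G) \<tau>) \<and>
              (has_type T (perm_topology T closure_of G) \<tau> \<longleftrightarrow> has_type T (Pk_closure T k G) \<tau>))"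
proof -
  have GA: "G \<subseteq> carrier (Aut T)"
    by (rule subgroup.subset[OF assms(2)])
  have G_closure: "G \<subseteq> perm_topology T closure_of G"
    by (rule closure_of_subset) (simp add: GA topspace_perm_topology)
  have closure_P: "perm_topology T closure_of G \<subseteq> Pk_closure T k G"
    by (rule closure_of_subset_Pk_closure[OF assms(1) GA])
  have "has_type T G \<tau> \<longleftrightarrow> has_type T (perm_topology T closure_of G) \<tau>" for \<tau>
    by (rule has_type_intermediate[OF assms G_closure closure_P])
  moreover have "has_type T G \<tau> \<longleftrightarrow> has_type T (Pk_closure T k G) \<tau>" for \<tau>
    using G_closure closure_P by (intro has_type_intermediate[OF assms]) blast+
  ultimately show ?thesis
    by (simp add: Type_def)
qed

end
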